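(* There are no fixed points in $\mathcal{M}_k$ under the action of a phase $P(\omega)$, where $\omega\in(-\pi,\pi)\setminus\{0\}$.
   Context: Monad matrices are $(A,B,C,D)$ with $A,B\in Mat_{k\times k}(\mathbb{C})$, $C\in Mat_{k\times 2}(\mathbb{C})$, $D\in Mat_{2\times k}(\mathbb{C})$, satisfying $[A,B]+CD=0$ and the full-rank conditions that $\begin{pmatrix}A-y\mathbb{1}_k\\ B-x\mathbb{1}_k\\ D\end{pmatrix}$ is injective and $\begin{pmatrix}x\mathbb{1}_k-B & A-y\mathbb{1}_k & C\end{pmatrix}$ is surjective for all $x,y\in\mathbb{C}$. $\mathcal{M}_k$ is the moduli space of non-singular monad matrices (those with $A\in GL(k,\mathbb{C})$) modulo $(A,B,C,D)\sim(gAg^{-1},gBg^{-1},gC,Dg^{-1})$, $g\in GL(k,\mathbb{C})$; it is identified with the moduli space of $(k,k)$-calorons. The phase $P(\omega)$ acts by $(A,B,C,D)\mapsto(A,B,Cq_\omega^{-1},q_\omega D)$ with $q_\omega=\mathrm{diag}(e^{-\imath\omega},e^{\imath\omega})$. *)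

theory Defs
  imports "HOL-Analysis.Analysis"
begin

text \<open>Monad matrices (A,B,C,D): A,B are k x k, C is k x 2, D is 2 x k.
  The size k is the cardinality of the finite index type 'k.\<close>

definition monad_matrices ::
  "complex^'k^'k \<Rightarrow> complex^'k^'k \<Rightarrow> complex^2^'k \<Rightarrow> complex^'k^2 \<Rightarrow> bool" where
  "monad_matrices A B C D =
     ((A ** B - B ** A) + C ** D = 0 \<and>
     (\<forall>x y :: complex.
        \<comment> \<open>injectivity of the stacked matrix (A - y I; B - x I; D)\<close>
        (\<forall>v :: complex^'k. (A - mat y) *v v = 0 \<and> (B - mat x) *v v = 0
              \<and> D *v v = 0 \<longrightarrow> v = 0) \<and>
        \<comment> \<open>surjectivity of the block matrix (x I - B, A - y I, C)\<close>
        (\<forall>w :: complex^'k. \<exists>u1 u2 :: complex^'k. \<exists>u3 :: complex^2.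
              (mat x - B) *v u1 + (A - mat y) *v u2 + C *v u3 = w)))"

definition nonsingular_monad ::
  "complex^'k^'k \<Rightarrow> complex^'k^'k \<Rightarrow> complex^2^'k \<Rightarrow> complex^'k^2 \<Rightarrow> bool" where
  "nonsingular_monad A B C D = (monad_matrices A B C D \<and> invertible A)"

text \<open>The GL(k) action: (A,B,C,D) ~ (gAg^-1, gBg^-1, gC, Dg^-1).
  monad_equiv A B C D A' B' C' D' says the two quadruples lie in the same orbit.\<close>
definition monad_equiv ::
  "complex^'k^'k \<Rightarrow> complex^'k^'k \<Rightarrow> complex^2^'k \<Rightarrow> complex^'k^2 \<Rightarrow>
   complex^'k^'k \<Rightarrow> complex^'k^'k \<Rightarrow> complex^2^'k \<Rightarrow> complex^'k^2 \<Rightarrow> bool" where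
  "monad_equiv A B C D A' B' C' D' =
     (\<exists>g :: complex^'k^'k. invertible g \<and>
        A' = g ** A ** matrix_inv g \<and> B' = g ** B ** matrix_inv g \<and>
        C' = g ** C \<and> D' = D ** matrix_inv g)"

text \<open>q_omega = diag(exp(-i omega), exp(i omega)).\<close>
definition q_phase :: "real \<Rightarrow> complex^2^2" where
  "q_phase \<omega> = (\<chi> i j. if i = j then (if i = 1 then exp (- \<i> * of_real \<omega>) else exp (\<i> * of_real \<omega>)) else 0)"

text \<open>P(omega): (A,B,C,D) |-> (A, B, C q^-1, q D), given componentwise on C and D.\<close>
definition phase_C :: "real \<Rightarrow> complex^2^'k \<Rightarrow> complex^2^'k" where
  "phase_C \<omega> C = C ** matrix_inv (q_phase \<omega>)"

definition phase_D :: "real \<Rightarrow> complex^'k^2 \<Rightarrow> complex^'k^2" where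
  "phase_D \<omega> D = q_phase \<omega> ** D"

end

theory Submission
  imports Defs "HOL-Computational_Algebra.Fundamental_Theorem_Algebra"
begin

text \<open>
  If g realises a fixed point, it commutes with A and B and acts on the two columns of C by the
  distinct scalars e^(i\<omega>), e^(-i\<omega>), dually on the rows of D. The A,B-invariant subspace generated
  by a column c lies in an eigenspace of g, on which the other row of D must vanish; there the
  commutator [A,B] = -CD has rank one with image spanned by c. A pair of operators with such a
  commutator has a common eigenvector in the kernel of the remaining row of D, contradicting the
  injectivity condition unless c = 0. Hence C = 0, so A and B commute; a common eigenvector of their
  transposes yields a linear form vanishing on the image of (x - B, A - y, C), contradicting
  surjectivity.
\<close>

section \<open>Eigenvectors in invariant subspaces\<close>

lemma mat_matrix_vector_mult: "mat a *v x = a *s (x::'a::comm_semiring_1^'k)"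
proof -
  have "(\<Sum>j\<in>UNIV. (if i = j then a else 0) * x $ j) = a * x $ i" for i
    by (simp add: if_distrib[of "\<lambda>t. t * _"] cong: if_cong)
  then show ?thesis by (simp add: vec_eq_iff matrix_vector_mult_def mat_def)
qed

definition poly_apply :: "'a::field^'k^'k \<Rightarrow> 'a poly \<Rightarrow> 'a^'k \<Rightarrow> 'a^'k" where
  "poly_apply M p = fold_coeffs (\<lambda>a f v. a *s v + M *v f v) p (\<lambda>v. 0)"

lemma poly_apply_0 [simp]: "poly_apply M 0 v = 0"
  by (simp add: poly_apply_def)

lemma poly_apply_pCons [simp]: "poly_apply M (pCons a p) v = a *s v + M *v poly_apply M p v"
  by (cases "p = 0 \<and> a = 0") (auto simp: poly_apply_def)

lemma poly_apply_add: "poly_apply M (p + q) v = poly_apply M p v + poly_apply M q v"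
proof (induction p arbitrary: q)
  case (pCons a p)
  then show ?case
    by (cases q) (simp add: matrix_vector_right_distrib vector_sadd_rdistrib algebra_simps)
qed simp

lemma poly_apply_diff: "poly_apply M (p - q) v = poly_apply M p v - poly_apply M q v"
  using poly_apply_add[of M "p - q" q v] by (simp add: algebra_simps)

lemma poly_apply_smult: "poly_apply M (smult c p) v = c *s poly_apply M p v"
  by (induction p)
    (auto simp: vector_scalar_commute vector_sadd_rdistrib vector_add_ldistrib vector_smult_assoc)

lemma poly_apply_mult: "poly_apply M (p * q) v = poly_apply M p (poly_apply M q v)"
  by (induction p arbitrary: v) (simp_all add: mult_pCons_left poly_apply_add poly_apply_smult)

lemma poly_apply_monom: "poly_apply M (monom c i) v = c *s ((*v) M ^^ i) v"
  by (induction i) (simp_all add: monom_0 monom_Suc vector_scalar_commute)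

lemma poly_apply_linear_factor: "poly_apply M [:-a, 1:] v = M *v v - a *s v"
  by (simp add: vec_eq_iff)

definition mat_invariant :: "'a::field^'k^'k \<Rightarrow> ('a^'k) set \<Rightarrow> bool" where
  "mat_invariant M S \<longleftrightarrow> (\<forall>x\<in>S. M *v x \<in> S)"

lemma poly_apply_in_subspace:
  "vec.subspace S \<Longrightarrow> mat_invariant M S \<Longrightarrow> v \<in> S \<Longrightarrow> poly_apply M p v \<in> S"
  by (induction p)
    (auto simp: mat_invariant_def vec.subspace_add vec.subspace_scale vec.subspace_0)

lemma annihilating_poly_exists:
  fixes M :: "'a::field^'k^'k"
  shows "\<exists>p. p \<noteq> 0 \<and> poly_apply M p v = 0"
proof -
  let ?f = "\<lambda>i. ((*v) M ^^ i) v"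
  define n where "n = CARD('k)"
  show ?thesis
  proof (cases "inj_on ?f {..n}")
    case False
    then obtain i j where ij: "i \<noteq> j" "?f i = ?f j"
      unfolding inj_on_def by auto
    let ?p = "monom 1 i - monom (1::'a) j"
    have "coeff ?p i = 1" using ij by (simp add: coeff_monom)
    then have "?p \<noteq> 0" by (metis coeff_0 zero_neq_one)
    moreover have "poly_apply M ?p v = 0" using ij by (simp add: poly_apply_diff poly_apply_monom)
    ultimately show ?thesis by blast
  next
    case True
    let ?T = "?f ` {..n}"
    have "vec.dim ?T \<le> n"
      using vec.dim_subset[of ?T UNIV] by (simp add: n_def vec.dim_UNIV card_cart_basis)
    then have "vec.dependent ?T"
      using True by (intro vec.dependent_biggerset_general) (simp add: card_image)
    then obtain t u where tu: "finite t" "t \<subseteq> ?T" "(\<Sum>w\<in>t. u w *s w) = 0" "\<exists>w\<in>t. u w \<noteq> 0"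
      unfolding vec.dependent_explicit by blast
    define a where "a i = (if ?f i \<in> t then u (?f i) else 0)" for i
    let ?p = "\<Sum>i\<le>n. monom (a i) i"
    have "poly_apply M (\<Sum>i\<in>I. monom (a i) i) v = (\<Sum>i\<in>I. a i *s ?f i)" if "finite I" for I
      using that by (induction I rule: finite_induct) (auto simp: poly_apply_add poly_apply_monom)
    then have "poly_apply M ?p v = (\<Sum>w\<in>?T. (if w \<in> t then u w else 0) *s w)"
      using True by (simp add: sum.reindex a_def)
    also have "\<dots> = (\<Sum>w\<in>t. u w *s w)"
      by (rule sum.mono_neutral_cong_right) (use tu in auto)
    finally have "poly_apply M ?p v = 0" using tu by simp
    moreover obtain j where j: "j \<le> n" "?f j \<in> t" "u (?f j) \<noteq> 0" using tu by auto
    then have "coeff ?p j \<noteq> 0" by (simp add: coeff_sum coeff_monom a_def)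
    then have "?p \<noteq> 0" by auto
    ultimately show ?thesis by blast
  qed
qed

lemma eigenvector_of_annihilated_vector:
  fixes M :: "complex^'k^'k"
  assumes S: "vec.subspace S" "mat_invariant M S"
  shows "v \<in> S \<Longrightarrow> v \<noteq> 0 \<Longrightarrow> p \<noteq> 0 \<Longrightarrow> poly_apply M p v = 0 \<Longrightarrow>
    \<exists>w\<in>S. w \<noteq> 0 \<and> (\<exists>a. M *v w = a *s w)"
proof (induction "degree p" arbitrary: p rule: less_induct)
  case less
  show ?case
  proof (cases "degree p = 0")
    case True
    then obtain c where "p = [:c:]" by (metis degree_eq_zeroE)
    with less show ?thesis by (auto simp: vector_mul_eq_0)
  next
    case False
    then obtain a where "poly p a = 0"
      by (metis fundamental_theorem_of_algebra constant_degree)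
    then obtain q where pq: "p = [:-a, 1:] * q" by (metis dvdE poly_eq_0_iff_dvd)
    with less.prems have "q \<noteq> 0" by auto
    then have deg: "degree q < degree p"
      unfolding pq by (subst degree_mult_eq) auto
    let ?u = "poly_apply M q v"
    have "M *v ?u - a *s ?u = 0"
      using less.prems(4) unfolding pq poly_apply_mult poly_apply_linear_factor .
    then have "M *v ?u = a *s ?u" by simp
    moreover have "?u \<in> S" using poly_apply_in_subspace S less.prems(1) by blast
    ultimately show ?thesis
      using less.hyps[OF deg] less.prems \<open>q \<noteq> 0\<close> by (cases "?u = 0") auto
  qed
qed

lemma invariant_subspace_has_eigenvector:
  fixes M :: "complex^'k^'k"
  assumes "vec.subspace S" "mat_invariant M S" "v \<in> S" "v \<noteq> 0"
  shows "\<exists>w\<in>S. w \<noteq> 0 \<and> (\<exists>a. M *v w = a *s w)"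
  using annihilating_poly_exists[of M v] eigenvector_of_annihilated_vector[OF assms] by blast

lemma subspace_eigenspace: "vec.subspace {x\<in>S. M *v x = a *s x}" if "vec.subspace S"
  using that unfolding vec.subspace_def
  by (auto simp: matrix_vector_right_distrib vector_scalar_commute vector_add_ldistrib
      vector_smult_assoc mult.commute)

lemma commuting_common_eigenvector:
  fixes A B :: "complex^'k^'k"
  assumes "A ** B = B ** A"
  shows "\<exists>w. w \<noteq> 0 \<and> (\<exists>a. A *v w = a *s w) \<and> (\<exists>b. B *v w = b *s w)"
proof -
  obtain i0 :: 'k where True by blast
  have "axis i0 (1::complex) \<noteq> 0" by (simp add: axis_eq_0_iff)
  then obtain w a where w: "w \<noteq> 0" "A *v w = a *s w"
    using invariant_subspace_has_eigenvector[OF vec.subspace_UNIV, of A "axis i0 1"]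
    by (auto simp: mat_invariant_def)
  let ?E = "{x\<in>UNIV. A *v x = a *s x}"
  have "A *v (B *v x) = B *v (A *v x)" for x
    using assms by (metis matrix_vector_mul_assoc)
  then have "mat_invariant B ?E"
    by (auto simp: mat_invariant_def vector_scalar_commute)
  then obtain z b where "z \<in> ?E" "z \<noteq> 0" "B *v z = b *s z"
    using invariant_subspace_has_eigenvector[OF subspace_eigenspace[OF vec.subspace_UNIV]] w
    by blast
  then show ?thesis by blast
qed

lemma subspace_image_eq_imp_inj_on:
  fixes M :: "'a::field^'k^'k"
  assumes S: "vec.subspace S" and im: "(*v) M ` S = S"
  shows "inj_on ((*v) M) S"
proof -
  obtain B where B: "B \<subseteq> S" "vec.independent B" "S \<subseteq> vec.span B" "card B = vec.dim S"
    using vec.basis_exists[of S] by blast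
  have fB: "finite B" using B(2) vec.finiteI_independent by blast
  have spB: "vec.span B = S" using B S by (metis vec.span_mono vec.span_eq_iff subset_antisym)
  have sp: "vec.span ((*v) M ` B) = S" using im spB by (simp add: vec.span_image)
  then have "vec.dim S \<le> card ((*v) M ` B)"
    using fB by (metis finite_imageI vec.dim_le_card order_refl)
  then have cB: "card ((*v) M ` B) = card B"
    by (metis B(4) card_image_le[OF fB] le_antisym)
  have indep: "vec.independent ((*v) M ` B)"
    using vec.card_le_dim_spanning[of "(*v) M ` B" S] cB B fB im sp by auto
  have "inj_on ((*v) M) B" using cB fB by (simp add: eq_card_imp_inj_on)
  then show ?thesis
    using vec.inj_on_span_iff_independent_image[OF indep] spB by simp
qed

section \<open>Operators with a rank one commutator\<close>

definition joint_invariant_span :: "'a::field^'k^'k \<Rightarrow> 'a^'k^'k \<Rightarrow> 'a^'k \<Rightarrow> ('a^'k) set" where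
  "joint_invariant_span A B c =
     \<Inter>{T. vec.subspace T \<and> c \<in> T \<and> mat_invariant A T \<and> mat_invariant B T}"

lemma joint_invariant_span_subspace: "vec.subspace (joint_invariant_span A B c)"
  unfolding joint_invariant_span_def vec.subspace_def by auto

lemma joint_invariant_span_invariant:
  "mat_invariant A (joint_invariant_span A B c)" "mat_invariant B (joint_invariant_span A B c)"
  unfolding joint_invariant_span_def mat_invariant_def by auto

lemma joint_invariant_span_base: "c \<in> joint_invariant_span A B c"
  unfolding joint_invariant_span_def by auto

lemma joint_invariant_span_minimal:
  "vec.subspace T \<Longrightarrow> c \<in> T \<Longrightarrow> mat_invariant A T \<Longrightarrow> mat_invariant B T \<Longrightarrow>
    joint_invariant_span A B c \<subseteq> T"
  unfolding joint_invariant_span_def by auto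

lemma rank_one_commutator_range:
  fixes A B :: "'a::field^'k^'k" and c :: "'a^'k"
  defines "S \<equiv> joint_invariant_span A B c"
  assumes comm: "\<forall>v\<in>S. A *v (B *v v) - B *v (A *v v) = \<delta> v *s c"
    and w: "w \<in> S" "A *v w = y *s w" "\<delta> w \<noteq> 0"
  shows "(*v) (A - mat y) ` S = S"
proof -
  let ?N = "A - mat y"
  let ?R = "(*v) ?N ` S"
  have sS: "vec.subspace S" and iA: "mat_invariant A S" and iB: "mat_invariant B S"
    unfolding S_def using joint_invariant_span_subspace joint_invariant_span_invariant by blast+
  have sR: "vec.subspace ?R" using sS vec.subspace_image by blast
  have N: "?N *v x = A *v x - y *s x" for x
    by (simp add: matrix_vector_mult_diff_rdistrib mat_matrix_vector_mult)
  have NA: "A *v (?N *v u) = ?N *v (A *v u)" for u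
    by (simp add: N matrix_vector_mult_diff_distrib vector_scalar_commute)
  have NB: "B *v (?N *v u) = ?N *v (B *v u) - \<delta> u *s c" if "u \<in> S" for u
  proof -
    have "A *v (B *v u) - B *v (A *v u) = \<delta> u *s c"
      using comm that by blast
    then have "B *v (A *v u) = A *v (B *v u) - \<delta> u *s c"
      by (subst (asm) eq_commute) simp
    then show ?thesis
      by (simp add: N matrix_vector_mult_diff_distrib vector_scalar_commute)
  qed
  have "?N *v (B *v w) = \<delta> w *s c"
    using NB[OF w(1)] w(2) by (simp add: N)
  then have "?N *v (inverse (\<delta> w) *s (B *v w)) = c"
    using w(3) by (simp add: vector_scalar_commute)
  moreover have "inverse (\<delta> w) *s (B *v w) \<in> S"
    using w(1) iB vec.subspace_scale[OF sS] by (auto simp: mat_invariant_def)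
  ultimately have cR: "c \<in> ?R" by (rule image_eqI[OF sym])
  have "mat_invariant A ?R"
    unfolding mat_invariant_def
  proof
    fix z assume "z \<in> ?R"
    then obtain u where u: "u \<in> S" "z = ?N *v u" by blast
    have "A *v u \<in> S" using u(1) iA by (simp add: mat_invariant_def)
    then show "A *v z \<in> ?R" unfolding u(2) NA by (rule imageI)
  qed
  moreover have "mat_invariant B ?R"
    unfolding mat_invariant_def
  proof
    fix z assume "z \<in> ?R"
    then obtain u where u: "u \<in> S" "z = ?N *v u" by blast
    have "?N *v (B *v u) \<in> ?R" using u(1) iB by (simp add: mat_invariant_def)
    moreover have "\<delta> u *s c \<in> ?R" using cR vec.subspace_scale[OF sR] by blast
    ultimately show "B *v z \<in> ?R"
      unfolding u(2) NB[OF u(1)] by (rule vec.subspace_diff[OF sR])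
  qed
  ultimately have "S \<subseteq> ?R"
    using joint_invariant_span_minimal[OF sR cR] unfolding S_def by blast
  moreover have "?R \<subseteq> S"
    using iA unfolding N mat_invariant_def
    by (auto intro!: vec.subspace_diff[OF sS] vec.subspace_scale[OF sS])
  ultimately show ?thesis by blast
qed

lemma rank_one_commutator_common_eigenvector:
  fixes A B :: "complex^'k^'k" and c :: "complex^'k" and \<delta> :: "complex^'k \<Rightarrow> complex"
  defines "S \<equiv> joint_invariant_span A B c"
  assumes "c \<noteq> 0"
    and comm: "\<forall>v\<in>S. A *v (B *v v) - B *v (A *v v) = \<delta> v *s c"
  shows "\<exists>v\<in>S. v \<noteq> 0 \<and> (\<exists>y. A *v v = y *s v) \<and> (\<exists>x. B *v v = x *s v) \<and> \<delta> v = 0"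
proof -
  have sS: "vec.subspace S" and iA: "mat_invariant A S" and iB: "mat_invariant B S"
    and cS: "c \<in> S"
    unfolding S_def using joint_invariant_span_subspace joint_invariant_span_invariant
      joint_invariant_span_base by blast+
  obtain w1 y where w1: "w1 \<in> S" "w1 \<noteq> 0" "A *v w1 = y *s w1"
    using invariant_subspace_has_eigenvector[OF sS iA cS \<open>c \<noteq> 0\<close>] by blast
  let ?E = "{x\<in>S. A *v x = y *s x}"
  \<comment> \<open>Otherwise A - y maps S onto S, although it kills w1.\<close>
  have "\<forall>w\<in>?E. \<delta> w = 0"
  proof (rule ccontr)
    assume "\<not> (\<forall>w\<in>?E. \<delta> w = 0)"
    then obtain w where "w \<in> S" "A *v w = y *s w" "\<delta> w \<noteq> 0" by blast
    then have "inj_on ((*v) (A - mat y)) S"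
      using rank_one_commutator_range comm sS unfolding S_def
      by (blast intro: subspace_image_eq_imp_inj_on)
    moreover have "(A - mat y) *v w1 = (A - mat y) *v 0"
      using w1 by (simp add: matrix_vector_mult_diff_rdistrib mat_matrix_vector_mult)
    ultimately have "w1 = 0"
      using w1(1) vec.subspace_0[OF sS] by (rule inj_onD)
    with w1(2) show False ..
  qed
  moreover have "mat_invariant B ?E"
    using iB comm calculation by (auto simp: mat_invariant_def vector_scalar_commute)
  then obtain z x where "z \<in> ?E" "z \<noteq> 0" "B *v z = x *s z"
    using invariant_subspace_has_eigenvector[OF subspace_eigenspace[OF sS]] w1 by blast
  ultimately show ?thesis by blast
qed

section \<open>A commuting pair is not jointly surjective\<close>

definition pairing :: "'a::comm_semiring_1^'k \<Rightarrow> 'a^'k \<Rightarrow> 'a" where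
  "pairing \<phi> z = (\<Sum>i\<in>UNIV. \<phi> $ i * z $ i)"

lemma pairing_matrix_vector_mult: "pairing \<phi> (M *v u) = pairing (transpose M *v \<phi>) u"
proof -
  have "pairing \<phi> (M *v u) = (\<Sum>i\<in>UNIV. \<Sum>j\<in>UNIV. \<phi> $ i * (M $ i $ j * u $ j))"
    unfolding pairing_def matrix_vector_mult_def by (simp add: sum_distrib_left)
  also have "\<dots> = (\<Sum>j\<in>UNIV. \<Sum>i\<in>UNIV. \<phi> $ i * (M $ i $ j * u $ j))"
    by (rule sum.swap)
  also have "\<dots> = pairing (transpose M *v \<phi>) u"
    unfolding pairing_def matrix_vector_mult_def transpose_def
    by (simp add: sum_distrib_left mult_ac)
  finally show ?thesis .
qed

lemma pairing_add: "pairing \<phi> (u + w) = pairing \<phi> u + pairing \<phi> w"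
  unfolding pairing_def by (simp add: distrib_left sum.distrib)

lemma pairing_diff: "pairing \<phi> (u - w) = pairing \<phi> u - pairing (\<phi>::'a::comm_ring_1^'k) w"
  unfolding pairing_def by (simp add: algebra_simps sum_subtractf)

lemma pairing_smult: "pairing \<phi> (a *s u) = a * pairing \<phi> u"
  unfolding pairing_def by (simp add: sum_distrib_left mult_ac)

lemma pairing_smult_left: "pairing (a *s \<phi>) u = a * pairing \<phi> u"
  unfolding pairing_def by (simp add: sum_distrib_left mult_ac)

lemma pairing_cnj_self:
  assumes "\<phi> \<noteq> 0"
  shows "pairing \<phi> (\<chi> i. cnj (\<phi> $ i)) \<noteq> 0"
proof
  assume "pairing \<phi> (\<chi> i. cnj (\<phi> $ i)) = 0"
  moreover have "complex_of_real (\<Sum>i\<in>UNIV. (cmod (\<phi> $ i))\<^sup>2) = pairing \<phi> (\<chi> i. cnj (\<phi> $ i))"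
    unfolding pairing_def of_real_sum by (simp only: complex_norm_square vec_lambda_beta)
  ultimately have "(\<Sum>i\<in>UNIV. (cmod (\<phi> $ i))\<^sup>2) = 0"
    by (metis of_real_eq_0_iff)
  then have "\<forall>i\<in>UNIV. (cmod (\<phi> $ i))\<^sup>2 = 0"
    by (subst sum_nonneg_eq_0_iff[symmetric]) auto
  with assms show False by (simp add: vec_eq_iff)
qed

lemma pairing_transpose_eigenvector:
  assumes "transpose M *v \<phi> = a *s \<phi>"
  shows "pairing \<phi> (M *v u) = a * pairing \<phi> u"
  unfolding pairing_matrix_vector_mult assms by (rule pairing_smult_left)

lemma commuting_pair_not_jointly_surjective:
  fixes A B :: "complex^'k^'k"
  assumes "A ** B = B ** A"
  shows "\<exists>x y w. \<forall>u1 u2. (mat x - B) *v u1 + (A - mat y) *v u2 \<noteq> w"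
proof -
  have "transpose A ** transpose B = transpose B ** transpose A"
    using assms by (metis matrix_transpose_mul)
  then obtain \<phi> a b where
    \<phi>: "\<phi> \<noteq> 0" "transpose A *v \<phi> = a *s \<phi>" "transpose B *v \<phi> = b *s \<phi>"
    using commuting_common_eigenvector by blast
  \<comment> \<open>The linear form pairing \<phi> kills the image, but not the conjugate of \<phi>.\<close>
  have "pairing \<phi> ((mat b - B) *v u1 + (A - mat a) *v u2) = 0" for u1 u2
    by (simp add: matrix_vector_mult_diff_rdistrib mat_matrix_vector_mult pairing_add pairing_diff
        pairing_smult pairing_transpose_eigenvector[OF \<phi>(2)]
        pairing_transpose_eigenvector[OF \<phi>(3)])
  then show ?thesis
    using pairing_cnj_self[OF \<phi>(1)] by metis
qed

section \<open>Matrices indexed by 2 and matrix inverses\<close>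

lemma UNIV_2_eq_pair: "(h::2) \<noteq> h' \<Longrightarrow> UNIV = {h, h'}"
  using exhaust_2 by (metis (full_types) UNIV_eq_I insert_iff)

lemma matrix_vector_mult_2_columns:
  fixes C :: "'a::comm_semiring_1^2^'k"
  assumes "h \<noteq> h'"
  shows "C *v x = x $ h *s column h C + x $ h' *s column h' C"
  using assms by (simp add: matrix_mult_sum UNIV_2_eq_pair[OF assms])

lemma vec_2_eq_0_iff:
  fixes x :: "'a::zero^2"
  assumes "h \<noteq> h'"
  shows "x = 0 \<longleftrightarrow> x $ h = 0 \<and> x $ h' = 0"
  using UNIV_2_eq_pair[OF assms] by (auto simp: vec_eq_iff)

definition diag2 :: "'a::zero \<Rightarrow> 'a \<Rightarrow> 'a^2^2" where
  "diag2 a b = (\<chi> i j. if i = j then (if i = 1 then a else b) else 0)"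

lemma diag2_mult_diag2: "diag2 a b ** diag2 c d = diag2 (a * c) (b * (d::'a::semiring_1))"
  by (auto simp: diag2_def vec_eq_iff matrix_matrix_mult_def sum_2 forall_2)

lemma diag2_1_1: "diag2 1 1 = (mat 1 :: 'a::semiring_1^2^2)"
  by (auto simp: diag2_def mat_def vec_eq_iff forall_2)

lemma diag2_vector_mult_nth: "(diag2 a b *v x) $ i = (if i = 1 then a else b) * x $ i"
  using exhaust_2[of i] by (auto simp: diag2_def matrix_vector_mult_def sum_2)

lemma column_mult_diag2:
  "column j (C ** diag2 a b) = ((if j = 1 then a else b)::'a::comm_semiring_1) *s column j C"
  using exhaust_2[of j]
  by (auto simp: diag2_def column_def vec_eq_iff matrix_matrix_mult_def sum_2 mult.commute)

lemma column_matrix_mult: "column j (g ** C) = g *v column j C"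
  by (simp add: column_def vec_eq_iff matrix_matrix_mult_def matrix_vector_mult_def)

lemma matrix_inv_unique:
  fixes A :: "'a::semiring_1^'n^'n"
  assumes "A ** A' = mat 1" "A' ** A = mat 1"
  shows "matrix_inv A = A'"
  unfolding matrix_inv_def
proof (rule some_equality)
  fix X assume X: "A ** X = mat 1 \<and> X ** A = mat 1"
  have "X = X ** (A ** A')"
    using assms(1) by (simp add: matrix_mul_rid)
  also have "\<dots> = (X ** A) ** A'"
    by (simp add: matrix_mul_assoc)
  finally show "X = A'" using X by (simp add: matrix_mul_lid)
qed (use assms in blast)

lemma matrix_inv:
  assumes "invertible (A :: 'a::semiring_1^'n^'n)"
  shows "A ** matrix_inv A = mat 1" "matrix_inv A ** A = mat 1"
  using someI_ex[OF assms[unfolded invertible_def]] by (simp_all add: matrix_inv_def)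

lemma intertwining_matrix_inv:
  fixes g :: "'a::semiring_1^'n^'n" and q :: "'a^'m^'m"
  assumes "invertible g" "q' ** q = mat 1" "q ** D = D ** matrix_inv g"
  shows "D ** g = q' ** D"
proof -
  have "D ** g = (q' ** q) ** D ** g"
    using assms(2) by (simp add: matrix_mul_lid)
  also have "\<dots> = q' ** ((q ** D) ** g)"
    by (simp add: matrix_mul_assoc)
  also have "\<dots> = q' ** D ** (matrix_inv g ** g)"
    using assms(3) by (simp add: matrix_mul_assoc)
  finally show ?thesis
    using matrix_inv(2)[OF assms(1)] by (simp add: matrix_mul_rid)
qed

lemma commute_if_conjugation_fixed:
  assumes "invertible g" "A = g ** A ** matrix_inv g"
  shows "A ** g = g ** (A :: 'a::semiring_1^'n^'n)"
proof -
  have "A ** g = g ** A ** (matrix_inv g ** g)"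
    using assms(2) by (metis matrix_mul_assoc)
  then show ?thesis using matrix_inv(2)[OF assms(1)] by (simp add: matrix_mul_rid)
qed

section \<open>Monads fixed by a diagonal phase\<close>

lemma monad_matrices_commutator:
  "monad_matrices A B C D \<Longrightarrow> A ** B - B ** A + C ** D = 0"
  unfolding monad_matrices_def by (rule conjunct1)

lemma monad_matrices_commutator_apply:
  assumes "monad_matrices A B C D"
  shows "A *v (B *v v) - B *v (A *v v) = - (C *v (D *v v))"
proof -
  have "(A ** B - B ** A + C ** D) *v v = 0"
    by (simp add: monad_matrices_commutator[OF assms])
  then have "A *v (B *v v) - B *v (A *v v) + C *v (D *v v) = 0"
    by (simp add: matrix_vector_mult_add_rdistrib matrix_vector_mult_diff_rdistrib
        matrix_vector_mul_assoc)
  then show ?thesis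
    by (simp add: eq_neg_iff_add_eq_0)
qed

lemma monad_matrices_injective:
  assumes "monad_matrices A B C D"
    and "A *v v = y *s v" "B *v v = x *s v" "D *v v = 0"
  shows "v = 0"
proof -
  have "\<forall>v. (A - mat y) *v v = 0 \<and> (B - mat x) *v v = 0 \<and> D *v v = 0 \<longrightarrow> v = 0"
    using assms(1) unfolding monad_matrices_def by blast
  moreover have "(A - mat y) *v v = 0" "(B - mat x) *v v = 0"
    using assms(2,3) by (simp_all add: matrix_vector_mult_diff_rdistrib mat_matrix_vector_mult)
  ultimately show ?thesis using assms(4) by blast
qed

lemma monad_matrices_surjective:
  assumes "monad_matrices A B C D"
  obtains u1 u2 u3 where "(mat x - B) *v u1 + (A - mat y) *v u2 + C *v u3 = w"
proof -
  have "\<forall>w. \<exists>u1 u2 u3. (mat x - B) *v u1 + (A - mat y) *v u2 + C *v u3 = w"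
    using assms unfolding monad_matrices_def by blast
  with that show ?thesis by blast
qed

lemma monad_matrices_C_neq_0:
  fixes A B :: "complex^'k^'k"
  assumes "monad_matrices A B C D"
  shows "C \<noteq> 0"
proof
  assume "C = 0"
  then have "A ** B = B ** A"
    using monad_matrices_commutator[OF assms] by simp
  then obtain x y w where "\<forall>u1 u2. (mat x - B) *v u1 + (A - mat y) *v u2 \<noteq> w"
    using commuting_pair_not_jointly_surjective by blast
  moreover obtain u1 u2 u3 where "(mat x - B) *v u1 + (A - mat y) *v u2 + C *v u3 = w"
    using monad_matrices_surjective[OF assms] .
  ultimately show False
    using \<open>C = 0\<close> by simp
qed

lemma phase_symmetric_column_eq_0:
  fixes A B g :: "complex^'k^'k" and C :: "complex^2^'k" and D :: "complex^'k^2"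
  assumes "h \<noteq> h'" and "\<alpha> \<noteq> \<beta>"
    and comm: "\<forall>v. A *v (B *v v) - B *v (A *v v) = - (C *v (D *v v))"
    and inj: "\<forall>v x y. A *v v = y *s v \<and> B *v v = x *s v \<and> D *v v = 0 \<longrightarrow> v = 0"
    and gA: "\<forall>v. g *v (A *v v) = A *v (g *v v)" and gB: "\<forall>v. g *v (B *v v) = B *v (g *v v)"
    and gC: "g *v column h C = \<alpha> *s column h C"
    and gD: "\<forall>v. (D *v (g *v v)) $ h' = \<beta> * (D *v v) $ h'"
  shows "column h C = 0"
proof (rule ccontr)
  assume c: "column h C \<noteq> 0"
  let ?S = "joint_invariant_span A B (column h C)"
  let ?E = "{v\<in>UNIV. g *v v = \<alpha> *s v}"
  \<comment> \<open>g acts on ?S by \<alpha>, so the \<beta>-equivariant row h' of D vanishes there.\<close>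
  have "?S \<subseteq> ?E"
    using gC gA gB
    by (intro joint_invariant_span_minimal subspace_eigenspace vec.subspace_UNIV)
      (auto simp: mat_invariant_def vector_scalar_commute)
  have Dh': "(D *v v) $ h' = 0" if "v \<in> ?S" for v
  proof -
    have "g *v v = \<alpha> *s v" using that \<open>?S \<subseteq> ?E\<close> by blast
    then have "\<alpha> * (D *v v) $ h' = \<beta> * (D *v v) $ h'"
      using gD by (metis vector_scalar_commute vector_smult_component)
    then show ?thesis using \<open>\<alpha> \<noteq> \<beta>\<close> by simp
  qed
  have "A *v (B *v v) - B *v (A *v v) = (- (D *v v) $ h) *s column h C" if "v \<in> ?S" for v
    using comm Dh'[OF that] matrix_vector_mult_2_columns[OF \<open>h \<noteq> h'\<close>, of C "D *v v"]
    by (simp add: vector_smult_lneg)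
  then obtain v x y where "v \<in> ?S" "v \<noteq> 0" "A *v v = y *s v" "B *v v = x *s v"
    "(D *v v) $ h = 0"
    using rank_one_commutator_common_eigenvector
        [where A = A and B = B and c = "column h C" and \<delta> = "\<lambda>v. - (D *v v) $ h"] c
    by auto
  then have "D *v v = 0"
    using Dh' vec_2_eq_0_iff[OF \<open>h \<noteq> h'\<close>] by blast
  with inj \<open>v \<noteq> 0\<close> \<open>A *v v = y *s v\<close> \<open>B *v v = x *s v\<close> show False by blast
qed

lemma monad_fixed_by_diagonal_phase_C_eq_0:
  fixes A B g :: "complex^'k^'k" and C :: "complex^2^'k" and D :: "complex^'k^2"
  assumes monad: "monad_matrices A B C D" and "\<alpha> \<noteq> \<beta>"
    and Ag: "A ** g = g ** A" and Bg: "B ** g = g ** B"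
    and gC: "g ** C = C ** diag2 \<alpha> \<beta>" and gD: "D ** g = diag2 \<alpha> \<beta> ** D"
  shows "C = 0"
proof -
  have comm: "\<forall>v. A *v (B *v v) - B *v (A *v v) = - (C *v (D *v v))"
    using monad_matrices_commutator_apply[OF monad] by blast
  have inj: "\<forall>v x y. A *v v = y *s v \<and> B *v v = x *s v \<and> D *v v = 0 \<longrightarrow> v = 0"
    using monad_matrices_injective[OF monad] by blast
  have gA: "\<forall>v. g *v (A *v v) = A *v (g *v v)" and gB: "\<forall>v. g *v (B *v v) = B *v (g *v v)"
    using Ag Bg by (simp_all add: matrix_vector_mul_assoc)
  have gcol: "g *v column j C = (if j = 1 then \<alpha> else \<beta>) *s column j C" for j
    using column_matrix_mult[of j g C] by (simp add: gC column_mult_diag2)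
  have grow: "(D *v (g *v v)) $ j = (if j = 1 then \<alpha> else \<beta>) * (D *v v) $ j" for v j
  proof -
    have "D *v (g *v v) = diag2 \<alpha> \<beta> *v (D *v v)"
      by (simp add: matrix_vector_mul_assoc gD)
    then show ?thesis by (simp add: diag2_vector_mult_nth)
  qed
  have "column 1 C = 0"
    by (rule phase_symmetric_column_eq_0[where h' = 2, OF _ \<open>\<alpha> \<noteq> \<beta>\<close> comm inj gA gB])
      (simp_all add: gcol grow)
  moreover have "column 2 C = 0"
    by (rule phase_symmetric_column_eq_0[where h' = 1, OF _ \<open>\<alpha> \<noteq> \<beta>\<close>[symmetric] comm inj gA gB])
      (simp_all add: gcol grow)
  ultimately show "C = 0"
    by (auto simp: vec_eq_iff column_def forall_2)
qed

lemma q_phase_inverse: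
  fixes \<omega> :: real
  defines "q' \<equiv> diag2 (exp (\<i> * of_real \<omega>)) (exp (- \<i> * of_real \<omega>))"
  shows "q' ** q_phase \<omega> = mat 1" "q_phase \<omega> ** q' = mat 1"
proof -
  have "q_phase \<omega> = diag2 (exp (- \<i> * of_real \<omega>)) (exp (\<i> * of_real \<omega>))"
    unfolding q_phase_def diag2_def ..
  then show "q' ** q_phase \<omega> = mat 1" "q_phase \<omega> ** q' = mat 1"
    by (simp_all add: q'_def diag2_mult_diag2 diag2_1_1 flip: exp_add)
qed

lemma exp_i_neq_exp_neg_i:
  assumes "-pi < \<omega>" "\<omega> < pi" "\<omega> \<noteq> 0"
  shows "exp (\<i> * of_real \<omega>) \<noteq> exp (- \<i> * of_real \<omega>)"
proof
  assume "exp (\<i> * of_real \<omega>) = exp (- \<i> * of_real \<omega>)"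
  then have "Im (exp (\<i> * of_real \<omega>)) = Im (exp (- \<i> * of_real \<omega>))" by simp
  then have "sin \<omega> = 0" by (simp add: Im_exp)
  with assms show False using sin_eq_0_pi by blast
qed

theorem mainTheorem3:
  fixes \<omega> :: real
    and A B :: "complex^'k::finite^'k" and C :: "complex^2^'k" and D :: "complex^'k^2"
  assumes "-pi < \<omega>" and "\<omega> < pi" and "\<omega> \<noteq> 0"
    and "nonsingular_monad A B C D"
  shows "\<not> monad_equiv A B C D A B (phase_C \<omega> C) (phase_D \<omega> D)"
proof
  assume "monad_equiv A B C D A B (phase_C \<omega> C) (phase_D \<omega> D)"
  then obtain g where g: "invertible g" "A = g ** A ** matrix_inv g" "B = g ** B ** matrix_inv g"
    "C ** matrix_inv (q_phase \<omega>) = g ** C" "q_phase \<omega> ** D = D ** matrix_inv g"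
    unfolding monad_equiv_def phase_C_def phase_D_def by blast
  have monad: "monad_matrices A B C D"
    using assms(4) by (simp add: nonsingular_monad_def)
  have "C = 0"
  proof (rule monad_fixed_by_diagonal_phase_C_eq_0[OF monad exp_i_neq_exp_neg_i[OF assms(1-3)]])
    show "A ** g = g ** A" "B ** g = g ** B"
      using commute_if_conjugation_fixed g(1-3) by blast+
    show "g ** C = C ** diag2 (exp (\<i> * of_real \<omega>)) (exp (- \<i> * of_real \<omega>))"
      using g(4) matrix_inv_unique[OF q_phase_inverse(2,1)] by simp
    show "D ** g = diag2 (exp (\<i> * of_real \<omega>)) (exp (- \<i> * of_real \<omega>)) ** D"
      by (rule intertwining_matrix_inv[OF g(1) q_phase_inverse(1) g(5)])
  qed
  with monad_matrices_C_neq_0[OF monad] show False ..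
qed

end
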